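(* For all non-negative integers $n$ and all positive integers $m$ and $r$, the integer $$\varphi(2n,m,r-1)=\sum_{k=0}^{2n}(-1)^k\binom{2n}{k}^m P(k,r)\,P(2n-k,r)$$ is divisible by the integer $\tfrac12 S(n,r)$.
   Context: For a non-negative integer $n$ and a positive integer $r$, the $n$th Gessel number of order $r$ is $$P(n,r)=\frac{r}{2(n+r)}\binom{2n}{n}\binom{2r}{r},$$ which is known to be an integer. The $n$th super Catalan number of order $r$ is $$S(n,r)=\frac{\binom{2n}{n}\binom{2r}{r}}{\binom{n+r}{n}},$$ which is known to be an even integer except when $n=r=0$; hence $\tfrac12 S(n,r)$ is an integer for every positive integer $r$. Divisibility is divisibility in $\mathbb{Z}$. *)

theory Defs
  imports Complex_Main
begin

text \<open>
  Both numbers are integers, so they are defined by integer division. For \<open>r \<ge> 1\<close> the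
  divisions, including \<open>super_catalan n r div 2\<close>, are exact: see \<open>gessel_eq\<close>,
  \<open>super_catalan_eq\<close> and \<open>even_super_catalan\<close> below.
\<close>

definition gessel :: "nat \<Rightarrow> nat \<Rightarrow> int" where
  "gessel n r = int (r * ((2 * n) choose n) * ((2 * r) choose r)) div int (2 * (n + r))"

definition super_catalan :: "nat \<Rightarrow> nat \<Rightarrow> int" where
  "super_catalan n r = int (((2 * n) choose n) * ((2 * r) choose r)) div int ((n + r) choose n)"

definition rat_super_catalan :: "nat \<Rightarrow> nat \<Rightarrow> rat" where
  "rat_super_catalan n r =
     of_nat ((2 * n) choose n) * of_nat ((2 * r) choose r) / of_nat ((n + r) choose n)"

lemma rat_super_catalan_fact:
  "rat_super_catalan n r = fact (2 * n) * fact (2 * r) / (fact n * fact r * fact (n + r))"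
proof -
  have c: "(of_nat ((2 * k) choose k) :: rat) = fact (2 * k) / (fact k * fact k)" for k
    by (simp add: binomial_fact mult_2)
  have d: "(of_nat ((n + r) choose n) :: rat) = fact (n + r) / (fact n * fact r)"
    by (simp add: binomial_fact)
  show ?thesis
    unfolding rat_super_catalan_def c d by (simp add: field_simps)
qed

lemma rat_super_catalan_Suc:
  "rat_super_catalan (Suc n) r = 4 * rat_super_catalan n r - rat_super_catalan n (Suc r)"
proof -
  have f: "(fact (2 * Suc k) :: rat) = 2 * (of_nat k + 1) * (2 * of_nat k + 1) * fact (2 * k)" for k
    by (simp add: algebra_simps)
  have g: "(fact (Suc k) :: rat) = (of_nat k + 1) * fact k" for k
    by (simp add: algebra_simps)
  have p: "(of_nat k + 1 :: rat) \<noteq> 0" for k :: nat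
    by (metis of_nat_Suc of_nat_neq_0 add.commute)
  have q: "(of_nat n + of_nat r + 1 :: rat) \<noteq> 0"
    using p[of "n + r"] by simp
  define A :: rat where "A = fact (2 * n) * fact (2 * r) / (fact n * fact r * fact (n + r))"
  have n1: "rat_super_catalan (Suc n) r = 2 * (2 * of_nat n + 1) * A / (of_nat n + of_nat r + 1)"
    unfolding rat_super_catalan_fact A_def f add_Suc g using p[of n] q by (simp add: divide_simps) (simp add: algebra_simps)
  have n2: "rat_super_catalan n (Suc r) = 2 * (2 * of_nat r + 1) * A / (of_nat n + of_nat r + 1)"
    unfolding rat_super_catalan_fact A_def f add_Suc_right g using p[of r] q by (simp add: divide_simps) (simp add: algebra_simps)
  have n3: "rat_super_catalan n r = A"
    unfolding rat_super_catalan_fact A_def ..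
  show ?thesis
    unfolding n1 n2 n3 using q by (simp add: field_simps)
qed

lemma even_central_binomial:
  assumes "r \<ge> 1"
  shows "even ((2 * r) choose r)"
proof -
  obtain s where s: "r = Suc s" using assms by (cases r) auto
  have "(2 * r) choose r = ((2 * s + 1) choose s) + ((2 * s + 1) choose Suc s)"
    by (simp add: s)
  moreover have "(2 * s + 1) choose Suc s = (2 * s + 1) choose s"
    using binomial_symmetric[of s "2 * s + 1"] by simp
  ultimately show ?thesis by simp
qed

lemma rat_super_catalan_even:
  assumes "r \<ge> 1"
  shows "\<exists>z :: int. rat_super_catalan n r = of_int (2 * z)"
  using assms
proof (induction n arbitrary: r)
  case 0
  obtain c where "(2 * r) choose r = 2 * c"
    using even_central_binomial[OF 0] by (elim evenE)
  then have "rat_super_catalan 0 r = of_int (2 * int c)"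
    by (simp add: rat_super_catalan_def)
  then show ?case ..
next
  case (Suc n)
  obtain a where a: "rat_super_catalan n r = of_int (2 * a)" using Suc by blast
  obtain b where b: "rat_super_catalan n (Suc r) = of_int (2 * b)" using Suc.IH[of "Suc r"] by auto
  have "rat_super_catalan (Suc n) r = of_int (2 * (4 * a - b))"
    unfolding rat_super_catalan_Suc a b by simp
  then show ?case ..
qed

lemma div_eqI_rat:
  assumes "(of_int a / of_int b :: rat) = of_int z" and "b \<noteq> 0"
  shows "a div b = z"
proof -
  have "(of_int a :: rat) = of_int (z * b)"
    using assms by (simp add: field_simps)
  then have "a = z * b" by (simp only: of_int_eq_iff)
  then show ?thesis using assms(2) by simp
qed

lemma super_catalan_eq:
  "of_int (super_catalan n r) =
    (of_nat ((2 * n) choose n) * of_nat ((2 * r) choose r) / of_nat ((n + r) choose n) :: rat)"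
proof -
  obtain z where "rat_super_catalan n r = of_int z"
  proof (cases "r = 0")
    case True
    then have "rat_super_catalan n r = of_int (int ((2 * n) choose n))"
      by (simp add: rat_super_catalan_def)
    then show ?thesis using that by blast
  next
    case False
    then have "r \<ge> 1" by simp
    then show ?thesis using rat_super_catalan_even that by blast
  qed
  moreover from this have "super_catalan n r = z"
    unfolding super_catalan_def
    by (intro div_eqI_rat) (simp_all add: rat_super_catalan_def)
  ultimately show ?thesis by (simp add: rat_super_catalan_def)
qed

lemma even_super_catalan:
  assumes "r \<ge> 1"
  shows "even (super_catalan n r)"
proof -
  obtain z where z: "rat_super_catalan n r = of_int (2 * z)"
    using rat_super_catalan_even[OF assms] by blast
  have "(of_int (super_catalan n r) :: rat) = of_int (2 * z)"
    using super_catalan_eq[of n r] z by (simp add: rat_super_catalan_def)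
  then show ?thesis by (metis of_int_eq_iff dvd_triv_left)
qed

lemma gessel_eq:
  assumes "r \<ge> 1"
  shows "of_int (gessel n r) =
    (of_nat r / (2 * (of_nat n + of_nat r)) * of_nat ((2 * n) choose n) * of_nat ((2 * r) choose r) :: rat)"
    (is "_ = ?P")
proof -
  obtain z where z: "rat_super_catalan n r = of_int (2 * z)"
    using rat_super_catalan_even[OF assms] by blast
  obtain s where s: "r = Suc s" using assms by (cases r) auto
  have "r * ((n + r) choose n) = (n + r) * ((n + s) choose n)"
    using binomial_absorb_comp[of "n + r" n] by (simp add: s)
  then have "(of_nat r * of_nat ((n + r) choose n) :: rat) = of_nat (n + r) * of_nat ((n + s) choose n)"
    by (metis of_nat_mult)
  moreover have "(of_nat (n + r) :: rat) \<noteq> 0" using assms by simp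
  ultimately have c: "(of_nat r / of_nat (n + r) * of_nat ((n + r) choose n) :: rat) = of_nat ((n + s) choose n)"
    by (simp add: field_simps)
  have prod: "(of_nat ((2 * n) choose n) * of_nat ((2 * r) choose r) :: rat)
      = of_int (2 * z) * of_nat ((n + r) choose n)"
    using z by (simp add: rat_super_catalan_def field_simps)
  have "?P = of_nat r / of_nat (n + r) / 2 * (of_nat ((2 * n) choose n) * of_nat ((2 * r) choose r))"
    by (simp add: algebra_simps)
  also have "\<dots> = of_int z * (of_nat r / of_nat (n + r) * of_nat ((n + r) choose n))"
    unfolding prod by (simp del: of_nat_add)
  also have "\<dots> = of_int (z * int ((n + s) choose n))"
    unfolding c by simp
  finally have P: "?P = of_int (z * int ((n + s) choose n))" .
  have "gessel n r = z * int ((n + s) choose n)"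
    unfolding gessel_def
    by (rule div_eqI_rat) (use P assms in \<open>simp_all add: algebra_simps\<close>)
  with P show ?thesis by simp
qed

end

theory Submission
  imports Defs "HOL-Computational_Algebra.Formal_Power_Series"
begin

text \<open>
  Put \<open>x = k\<close> and \<open>y = 2 * n - k\<close>. The summand is \<open>(-1) ^ k\<close> times a function of
  \<open>(x, y)\<close>, and the idea is to expand that function in the products
  \<open>(x choose u) * (y choose u)\<close>. Two facts make these products useful: multiplication by
  \<open>(x + y) choose x\<close> carries each of them to a combination of them with natural coefficients
  (\<open>binomial_times_basis\<close>), and the alternating sum of one of them against
  \<open>(2 * n) choose k\<close> vanishes unless \<open>u = n\<close> (\<open>alternating_basis_sum\<close>).

  A Gessel number is half a super Catalan number times a binomial coefficient,
  \<open>P(k, r) = S(k, r) / 2 * ((k + r - 1) choose (r - 1))\<close>. The two binomial coefficients coming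
  from \<open>P(k, r) * P(2 * n - k, r)\<close> have a product that is a natural combination of the
  \<open>(x choose u) * (y choose u)\<close> (\<open>binomial_product_expansion\<close>). Hence it suffices that
  \<open>S(n, r) / 2\<close> divides, for every \<open>u\<close>,
  \<open>\<Sum>k. (-1) ^ k * ((2 * n) choose k) ^ m * (x choose u) * (y choose u) * S(x, r) / 2 * S(y, r) / 2\<close>,
  and \<open>binomial_times_basis\<close> reduces this, by induction on \<open>m\<close>, to \<open>m = 1\<close>.

  For \<open>m = 1\<close> the sum has a closed form, an instance of Dixon's theorem on well-poised series
  (\<open>weighted_alternating_super_catalan_sum\<close>): for \<open>u \<le> n\<close> it is
  \<open>(-1) ^ u * ((2 * u) choose u) * (n choose u) * S(n, n + r - u) / 2 * S(n, r) / 2\<close>, visibly a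
  multiple of \<open>S(n, r) / 2\<close>; for \<open>u > n\<close> one of \<open>x\<close>, \<open>y\<close> is below \<open>u\<close> and every
  summand is zero. The closed form comes from expanding the product of two super Catalan
  numbers, this time with rational coefficients, in the same products
  (\<open>super_catalan_product_expansion\<close>): after summation a single term of that expansion survives.

  Both expansions, of the product of binomial coefficients and of the product of super Catalan
  numbers, are instances of one Pfaff--Saalschuetz identity (\<open>saalschuetz_gbinomial\<close>).
\<close>

section \<open>A Saalschuetz identity for binomial coefficients\<close>

text \<open>
  A bound \<open>K\<close> larger than \<open>v\<close> is allowed so that the identity applies inside double sums
  whose ranges have been made independent of each other.
\<close>

lemma vandermonde_shifted:
  fixes v n D K :: nat
  assumes "v \<le> K"
  shows "(\<Sum>i\<le>K. (v choose i) * (n choose (D + i))) = (v + n) choose (v + D)"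
proof -
  have "(v + n) choose (v + D) = (\<Sum>k\<le>v + D. (v choose k) * (n choose (v + D - k)))"
    by (rule vandermonde[symmetric])
  also have "\<dots> = (\<Sum>k\<le>v. (v choose k) * (n choose (v + D - k)))"
    by (rule sum.mono_neutral_right) auto
  also have "\<dots> = (\<Sum>i\<le>v. (v choose i) * (n choose (D + i)))"
    by (rule sum.reindex_bij_witness[of _ "\<lambda>i. v - i" "\<lambda>i. v - i"])
      (auto simp: binomial_symmetric[symmetric] add.commute)
  also have "\<dots> = (\<Sum>i\<le>K. (v choose i) * (n choose (D + i)))"
    using assms by (intro sum.mono_neutral_left) auto
  finally show ?thesis ..
qed

lemma of_nat_binomial_add:
  fixes a b :: nat
  shows "(of_nat ((a + b) choose b) :: 'a :: field_char_0) = fact (a + b) / (fact a * fact b)"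
  by (simp add: binomial_fact)

lemma trinomial_coefficient_split:
  fixes a b c :: nat
  shows "((a + b + c) choose b) * ((a + c) choose c) = ((a + b) choose b) * ((a + b + c) choose c)"
proof -
  have e: "a + c + b = a + b + c" by simp
  have "(of_nat (((a + b + c) choose b) * ((a + c) choose c)) :: rat)
      = of_nat (((a + b) choose b) * ((a + b + c) choose c))"
    unfolding of_nat_mult of_nat_binomial_add[of "a + c" b, unfolded e] of_nat_binomial_add[of a c]
      of_nat_binomial_add[of a b] of_nat_binomial_add[of "a + b" c]
    by (simp add: divide_simps del: fact_Suc)
  then show ?thesis by (simp only: of_nat_eq_iff)
qed

text \<open>
  Vandermonde's convolution for \<open>(A - i) + E\<close>, followed by the trinomial revision
  \<open>(A gchoose i) * ((A - i) gchoose (v - i)) = (A gchoose v) * (v choose i)\<close>. It moves the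
  dependence on \<open>i\<close> out of the upper arguments into a natural binomial coefficient, which also
  kills the terms with \<open>v < i\<close>.
\<close>

lemma gbinomial_split_shifted:
  fixes A :: "'a :: field_char_0" and E i x :: nat
  assumes "i \<le> x"
  shows "(A gchoose i) * ((A + of_nat E - of_nat i) gchoose (x - i))
    = (\<Sum>v\<le>x. (A gchoose v) * of_nat (v choose i) * of_nat (E choose (x - v)))"
proof -
  have "(A + of_nat E - of_nat i) gchoose (x - i) = ((A - of_nat i) + of_nat E) gchoose (x - i)"
    by (simp add: algebra_simps)
  also have "\<dots> = (\<Sum>w=0..x - i. ((A - of_nat i) gchoose w) * (of_nat E gchoose (x - i - w)))"
    by (rule gbinomial_Vandermonde[symmetric])
  also have "\<dots> = (\<Sum>v=i..x. ((A - of_nat i) gchoose (v - i)) * of_nat (E choose (x - v)))"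
    by (rule sum.reindex_bij_witness[of _ "\<lambda>v. v - i" "\<lambda>w. w + i"])
      (use assms in \<open>auto simp: binomial_gbinomial add.commute[of _ i]\<close>)
  finally have "(A gchoose i) * ((A + of_nat E - of_nat i) gchoose (x - i))
      = (\<Sum>v=i..x. (A gchoose i) * ((A - of_nat i) gchoose (v - i)) * of_nat (E choose (x - v)))"
    by (simp add: sum_distrib_left mult.assoc)
  also have "\<dots> = (\<Sum>v=i..x. (A gchoose v) * of_nat (v choose i) * of_nat (E choose (x - v)))"
    by (rule sum.cong) (simp_all add: gbinomial_trinomial_revision[symmetric] binomial_gbinomial)
  also have "\<dots> = (\<Sum>v\<le>x. (A gchoose v) * of_nat (v choose i) * of_nat (E choose (x - v)))"
    by (rule sum.mono_neutral_left) auto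
  finally show ?thesis .
qed

text \<open>
  Once the product of the first two factors is split by \<open>gbinomial_split_shifted\<close>, the sum over
  \<open>i\<close> and then the sum over \<open>v\<close> are Vandermonde convolutions. The argument \<open>A\<close> has to be a field element, since super
  Catalan numbers need the half-integer \<open>A = - r - 1 / 2\<close>. Writing the last factor as
  \<open>(D + y) choose (D + i)\<close> rather than as \<open>(D + y) choose (y - i)\<close> makes the terms with
  \<open>i > y\<close> vanish, where truncated subtraction would give \<open>1\<close>.
\<close>

lemma saalschuetz_gbinomial:
  fixes A :: "'a :: field_char_0" and D x y :: nat
  shows "((A + of_nat (D + x)) gchoose x) * of_nat ((D + x + y) choose y)
    = (\<Sum>i\<le>x. (A gchoose i) * ((A + of_nat (D + x + y) - of_nat i) gchoose (x - i))
          * of_nat ((D + y) choose (D + i)))"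
proof -
  \<comment> \<open>After the sum over \<open>i\<close> is evaluated, this takes one factor out of the sum over \<open>v\<close>.\<close>
  have *: "((D + x + y) choose (x - v)) * ((v + (D + y)) choose (v + D))
      = ((D + x) choose (x - v)) * ((D + x + y) choose y)" if "v \<le> x" for v
  proof -
    from le_Suc_ex[OF that] obtain w where x: "x = v + w" by blast
    have "(v + (D + y)) choose (v + D) = (v + D + y) choose y"
      using binomial_symmetric[of y "v + D + y"] by (simp add: add.assoc)
    then show ?thesis
      using trinomial_coefficient_split[of "v + D" w y] by (simp add: x add_ac)
  qed
  have "(\<Sum>i\<le>x. (A gchoose i) * ((A + of_nat (D + x + y) - of_nat i) gchoose (x - i))
          * of_nat ((D + y) choose (D + i)))
      = (\<Sum>i\<le>x. \<Sum>v\<le>x. (A gchoose v) * of_nat (v choose i)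
          * of_nat ((D + x + y) choose (x - v)) * of_nat ((D + y) choose (D + i)))"
    by (intro sum.cong refl, subst gbinomial_split_shifted) (simp_all add: sum_distrib_right)
  also have "\<dots> = (\<Sum>v\<le>x. (A gchoose v) * of_nat ((D + x + y) choose (x - v))
          * of_nat (\<Sum>i\<le>x. (v choose i) * ((D + y) choose (D + i))))"
    by (subst sum.swap) (simp add: sum_distrib_left mult_ac)
  also have "\<dots> = (\<Sum>v\<le>x. (A gchoose v) * of_nat (((D + x + y) choose (x - v))
          * ((v + (D + y)) choose (v + D))))"
    by (intro sum.cong refl) (simp add: vandermonde_shifted mult.assoc)
  also have "\<dots> = (\<Sum>v\<le>x. (A gchoose v) * (of_nat (D + x) gchoose (x - v)))
          * of_nat ((D + x + y) choose y)"
    unfolding sum_distrib_right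
    by (rule sum.cong[OF refl], subst *) (simp_all only: atMost_iff of_nat_mult binomial_gbinomial mult_ac)
  also have "(\<Sum>v\<le>x. (A gchoose v) * (of_nat (D + x) gchoose (x - v)))
      = (A + of_nat (D + x)) gchoose x"
    using gbinomial_Vandermonde[of A "of_nat (D + x)" x] by (simp add: atMost_atLeast0)
  finally show ?thesis ..
qed

section \<open>The products of binomial coefficients with complementary arguments\<close>

text \<open>
  The case \<open>D = 0\<close>, \<open>A = x\<close> of \<open>saalschuetz_gbinomial\<close>, with \<open>p\<close> in the role of its
  \<open>x\<close>. The coefficient
  \<open>(x + y + p - u) choose (p - u)\<close> depends on \<open>x\<close> and \<open>y\<close> through \<open>x + y\<close> only, which
  is what allows it to leave a sum over \<open>k\<close> with \<open>x = k\<close> and \<open>y = 2 * n - k\<close>.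
\<close>

lemma binomial_product_expansion:
  fixes x y p :: nat
  shows "((x + p) choose p) * ((y + p) choose p)
    = (\<Sum>u\<le>p. ((x + y + p - u) choose (p - u)) * (x choose u) * (y choose u))"
proof -
  have "(rat_of_nat (((x + p) choose p) * ((y + p) choose p)))
     = of_nat (\<Sum>u\<le>p. ((x + y + p - u) choose (p - u)) * (x choose u) * (y choose u))"
  proof -
    have s: "(y + p) choose p = (p + y) choose y"
      using binomial_symmetric[of p "y + p"] by (simp add: add.commute)
    have g: "(rat_of_nat x + of_nat (p + y) - of_nat u) gchoose (p - u)
        = of_nat ((x + y + p - u) choose (p - u))" if "u \<le> p" for u
    proof -
      have "(rat_of_nat x + of_nat (p + y) - of_nat u) = of_nat (x + y + p - u)"
        using that by (simp add: of_nat_diff)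
      then show ?thesis by (simp only: binomial_gbinomial)
    qed
    have "rat_of_nat (((x + p) choose p) * ((y + p) choose p))
        = ((rat_of_nat x + of_nat (0 + p)) gchoose p) * of_nat ((0 + p + y) choose y)"
      by (simp add: s binomial_gbinomial)
    also have "\<dots> = (\<Sum>i\<le>p. (rat_of_nat x gchoose i)
        * ((rat_of_nat x + of_nat (0 + p + y) - of_nat i) gchoose (p - i))
        * of_nat ((0 + y) choose (0 + i)))"
      by (rule saalschuetz_gbinomial)
    also have "\<dots> = (\<Sum>u\<le>p. of_nat (((x + y + p - u) choose (p - u)) * (x choose u) * (y choose u)))"
      by (rule sum.cong[OF refl])
        (simp only: add_0 g atMost_iff of_nat_mult binomial_gbinomial[symmetric] mult_ac)
    finally show ?thesis by (simp only: of_nat_sum)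
  qed
  then show ?thesis by (simp only: of_nat_eq_iff)
qed

text \<open>
  Trinomial revision turns \<open>(v choose j) * (x choose v)\<close> into
  \<open>(x choose j) * ((x - j) choose (v - j))\<close>, and the sum over \<open>v\<close> becomes a Vandermonde
  convolution. Again the coefficients \<open>((x + y) choose j) * (v choose j)\<close> involve only
  \<open>x + y\<close>.
\<close>

lemma binomial_times_basis:
  fixes x y j :: nat
  shows "((x + y) choose x) * (x choose j) * (y choose j)
    = ((x + y) choose j) * (\<Sum>v\<le>x. (v choose j) * (x choose v) * (y choose v))"
proof (cases "j \<le> x")
  case True
  have "(\<Sum>v\<le>x. (v choose j) * (x choose v) * (y choose v))
      = (\<Sum>v=j..x. (v choose j) * (x choose v) * (y choose v))"
    by (rule sum.mono_neutral_right) auto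
  also have "\<dots> = (\<Sum>v=j..x. (x choose j) * (((x - j) choose (v - j)) * (y choose v)))"
    by (rule sum.cong) (use choose_mult in \<open>auto simp: mult_ac\<close>)
  also have "\<dots> = (x choose j) * (\<Sum>i\<le>x - j. ((x - j) choose i) * (y choose (j + i)))"
    unfolding sum_distrib_left
    by (rule sum.reindex_bij_witness[of _ "\<lambda>i. j + i" "\<lambda>v. v - j"]) (use True in auto)
  also have "\<dots> = (x choose j) * ((x + y - j) choose x)"
    using True by (simp add: vandermonde_shifted)
  finally have s: "(\<Sum>v\<le>x. (v choose j) * (x choose v) * (y choose v))
      = (x choose j) * ((x + y - j) choose x)" .
  have "((x + y) choose x) * (y choose j) = ((x + y) choose j) * ((x + y - j) choose x)"
  proof (cases "j \<le> y")
    case True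
    then obtain w where y: "y = j + w" by (metis le_Suc_ex)
    have "(of_nat (((x + y) choose x) * (y choose j)) :: rat)
        = of_nat (((x + y) choose j) * ((x + y - j) choose x))"
      by (simp add: y binomial_fact)
    then show ?thesis by (simp only: of_nat_eq_iff)
  next
    case False
    then show ?thesis using \<open>j \<le> x\<close> by (simp add: binomial_eq_0)
  qed
  then show ?thesis unfolding s by (simp add: mult_ac)
next
  case False
  then show ?thesis by (simp add: binomial_eq_0)
qed

lemma binomial_basis_factor:
  fixes M k u :: nat
  assumes "k + 2 * u \<le> M"
  shows "(M choose (k + u)) * ((k + u) choose u) * ((M - (k + u)) choose u)
    = (M choose u) * ((M - u) choose u) * ((M - 2 * u) choose k)"
proof -
  from le_Suc_ex[OF assms] obtain w where M: "M = k + 2 * u + w" by blast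
  have e: "w + u + (k + u) = M" "k + w + u + u = M" "w + k = k + w" by (simp_all add: M)
  have d: "M - (k + u) = w + u" "M - u = k + w + u" "M - 2 * u = k + w" by (simp_all add: M)
  have "(of_nat ((M choose (k + u)) * ((k + u) choose u) * ((w + u) choose u)) :: rat)
      = of_nat ((M choose u) * ((k + w + u) choose u) * ((k + w) choose k))"
    unfolding of_nat_mult of_nat_binomial_add[of "w + u" "k + u", unfolded e]
      of_nat_binomial_add[of "k + w + u" u, unfolded e] of_nat_binomial_add[of "k + w" u]
      of_nat_binomial_add[of k u] of_nat_binomial_add[of w u] of_nat_binomial_add[of w k, unfolded e]
    by (simp add: divide_simps del: fact_Suc)
  then show ?thesis unfolding d by (simp only: of_nat_eq_iff)
qed

text \<open>
  Against \<open>M choose k\<close>, the weight \<open>(k choose u) * ((M - k) choose u)\<close> up to a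
  constant merely shortens the sum by \<open>u\<close> terms at each end.
\<close>

lemma basis_sum_shift:
  fixes M u :: nat and h :: "nat \<Rightarrow> 'a :: comm_semiring_1"
  assumes "2 * u \<le> M"
  shows "(\<Sum>k\<le>M. of_nat ((M choose k) * (k choose u) * ((M - k) choose u)) * h k)
    = of_nat ((M choose u) * ((M - u) choose u))
      * (\<Sum>k\<le>M - 2 * u. of_nat ((M - 2 * u) choose k) * h (k + u))"
proof -
  have "(\<Sum>k\<le>M. of_nat ((M choose k) * (k choose u) * ((M - k) choose u)) * h k)
      = (\<Sum>k=u..M - u. of_nat ((M choose k) * (k choose u) * ((M - k) choose u)) * h k)"
    by (rule sum.mono_neutral_right) (auto simp: binomial_eq_0)
  also have "\<dots> = (\<Sum>k\<le>M - 2 * u.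
      of_nat ((M choose (k + u)) * ((k + u) choose u) * ((M - (k + u)) choose u)) * h (k + u))"
    by (rule sum.reindex_bij_witness[of _ "\<lambda>k. k + u" "\<lambda>k. k - u"]) (use assms in auto)
  also have "\<dots> = (\<Sum>k\<le>M - 2 * u. of_nat ((M choose u) * ((M - u) choose u))
      * (of_nat ((M - 2 * u) choose k) * h (k + u)))"
    by (rule sum.cong[OF refl], subst binomial_basis_factor) (use assms in \<open>auto simp: mult.assoc\<close>)
  finally show ?thesis by (simp only: sum_distrib_left)
qed

text \<open>
  After the shift the sum is the alternating sum of a row of Pascal's triangle, of length
  \<open>2 * N - 2 * i\<close>, which vanishes unless the row is trivial.
\<close>

lemma alternating_basis_sum:
  fixes N i :: nat
  shows "(\<Sum>k\<le>2 * N. (-1) ^ k * of_nat (((2 * N) choose k) * (k choose i) * ((2 * N - k) choose i)))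
    = (if i = N then (-1) ^ N * of_nat ((2 * N) choose N) else 0 :: 'a :: idom)"
    (is "?s = ?t")
proof (cases "i \<le> N")
  case True
  define d where "d = N - i"
  have N: "N = i + d" using True by (simp add: d_def)
  have "?s = (\<Sum>k\<le>2 * N. of_nat (((2 * N) choose k) * (k choose i) * ((2 * N - k) choose i)) * (-1) ^ k)"
    by (simp only: mult.commute)
  also have "\<dots> = of_nat (((2 * N) choose i) * ((2 * N - i) choose i))
      * (\<Sum>k\<le>2 * N - 2 * i. of_nat ((2 * N - 2 * i) choose k) * (-1) ^ (k + i))"
    by (rule basis_sum_shift) (simp add: N)
  also have "\<dots> = of_nat (((2 * N) choose i) * ((2 * N - i) choose i)) * (-1) ^ i
      * (\<Sum>k\<le>2 * d. (-1) ^ k * of_nat ((2 * d) choose k))"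
    by (simp add: N power_add sum_distrib_left mult_ac)
  also have "\<dots> = ?t"
    using choose_alternating_sum[of "2 * d", where ?'a = 'a] by (cases "d = 0") (auto simp: N)
  finally show ?thesis .
next
  case False
  have "(k choose i) * ((2 * N - k) choose i) = 0" for k
    using False by (auto simp: binomial_eq_0_iff)
  then have "?s = 0" by (simp only: mult.assoc mult_zero_right of_nat_0 sum.neutral_const)
  then show ?thesis using False by simp
qed

section \<open>Products of two super Catalan numbers\<close>

lemma gbinomial_half:
  fixes m x :: nat
  shows "((of_nat (m + x) - 1 / 2 :: rat) gchoose x)
    = fact (2 * (m + x)) * fact m / (4 ^ x * fact (m + x) * fact (2 * m) * fact x)"
proof (induction x)
  case 0
  show ?case by simp
next
  case (Suc x)
  define k where "k = m + x"
  have f: "(fact (2 * Suc k) :: rat) = 2 * (of_nat k + 1) * (2 * of_nat k + 1) * fact (2 * k)"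
    by (simp add: algebra_simps)
  have g: "(fact (Suc l) :: rat) = (of_nat l + 1) * fact l" for l
    by (simp add: algebra_simps)
  have nz: "(of_nat l + 1 :: rat) \<noteq> 0" for l
    by (metis of_nat_Suc of_nat_neq_0 add.commute)
  have "(of_nat (Suc k) - 1 / 2 :: rat) gchoose Suc x
     = (of_nat k + 1 / 2) / (of_nat x + 1) * ((of_nat k - 1 / 2) gchoose x)"
    using gbinomial_factors[of "of_nat k - 1 / 2 :: rat" x] by (simp add: algebra_simps)
  also have "\<dots> = (of_nat k + 1 / 2) / (of_nat x + 1)
      * (fact (2 * k) * fact m / (4 ^ x * fact k * fact (2 * m) * fact x))"
    using Suc by (simp add: k_def)
  also have "\<dots> = fact (2 * Suc k) * fact m / (4 ^ Suc x * fact (Suc k) * fact (2 * m) * fact (Suc x))"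
    unfolding f g using nz[of k] nz[of x] by (simp add: divide_simps) (simp add: algebra_simps)
  finally show ?case by (simp only: k_def add_Suc_right)
qed

lemma gbinomial_negative_half:
  fixes r i :: nat
  shows "((- of_nat r - 1 / 2 :: rat) gchoose i)
    = (-1) ^ i * (fact (2 * (r + i)) * fact r / (4 ^ i * fact (r + i) * fact (2 * r) * fact i))"
  using gbinomial_minus[of "of_nat r + 1 / 2 :: rat" i] gbinomial_half[of r i]
  by (simp add: algebra_simps)


text \<open>
  As a function of \<open>x\<close>, the number \<open>S(j + x, r)\<close> is proportional to
  \<open>4 ^ x * (1/2) (3/2) \<dots> (j + x - 1/2) / fact (j + r + x)\<close>. Up to normalisation, the product
  \<open>S(j + x, r) * S(j + y, r)\<close> is therefore the left-hand side of \<open>saalschuetz_gbinomial\<close> with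
  \<open>D = j + r\<close> and \<open>A = - r - 1 / 2\<close>. The shift \<open>j\<close> serves to absorb the weight
  \<open>(k choose u) * ((2 * n - k) choose u)\<close> later on.
\<close>

lemma super_catalan_product_expansion:
  fixes j r x y :: nat
  shows "rat_super_catalan (j + x) r * rat_super_catalan (j + y) r
    = (\<Sum>i\<le>x. (-1) ^ i * fact i * rat_super_catalan j (r + i) * rat_super_catalan (j + x + y - i) r
         * (fact (j + r + x + y - i) / fact (j + r + x + y))
         * of_nat ((x choose i) * (y choose i)))"
proof -
  \<comment> \<open>The normalising factor between the two left-hand sides.\<close>
  define c :: rat where
    "c = 4 ^ x * fact (2 * j) * fact x * fact y * fact (2 * r) / (fact j * fact (j + r + x + y) * fact r)
       * rat_super_catalan (j + y) r"
  define A :: rat where "A = - of_nat r - 1 / 2"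
  define t where "t i = (A gchoose i) * ((A + of_nat (j + r + x + y) - of_nat i) gchoose (x - i))
          * of_nat ((j + r + y) choose (j + r + i))" for i
  have left: "(A + of_nat (j + r + x)) gchoose x
      = fact (2 * (j + x)) * fact j / (4 ^ x * fact (j + x) * fact (2 * j) * fact x)"
  proof -
    have "A + of_nat (j + r + x) = of_nat (j + x) - 1 / 2" by (simp add: A_def)
    then show ?thesis by (simp only: gbinomial_half)
  qed
  have "rat_super_catalan (j + x) r * rat_super_catalan (j + y) r
      = c * (((A + of_nat (j + r + x)) gchoose x) * of_nat ((j + r + x + y) choose y))"
    unfolding left c_def by (simp add: rat_super_catalan_fact binomial_fact add_ac mult_ac)
  also have "\<dots> = (\<Sum>i\<le>x. c * t i)"
    unfolding saalschuetz_gbinomial t_def by (simp only: sum_distrib_left)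
  also have "\<dots> = (\<Sum>i\<le>x. (-1) ^ i * fact i * rat_super_catalan j (r + i) * rat_super_catalan (j + x + y - i) r
         * (fact (j + r + x + y - i) / fact (j + r + x + y))
         * of_nat ((x choose i) * (y choose i)))"
  proof (rule sum.cong[OF refl])
    fix i assume "i \<in> {..x}"
    then obtain w where x: "x = i + w" by (auto dest: le_Suc_ex)
    show "c * t i = (-1) ^ i * fact i * rat_super_catalan j (r + i) * rat_super_catalan (j + x + y - i) r
         * (fact (j + r + x + y - i) / fact (j + r + x + y))
         * of_nat ((x choose i) * (y choose i))"
    proof (cases "i \<le> y")
      case True
      then obtain z where y: "y = i + z" by (auto dest: le_Suc_ex)
      have "A + of_nat (j + r + x + y) - of_nat i = of_nat (j + y + w) - 1 / 2"
        by (simp add: A_def x)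
      then have second: "(A + of_nat (j + r + x + y) - of_nat i) gchoose (x - i)
          = fact (2 * (j + y + w)) * fact (j + y) / (4 ^ w * fact (j + y + w) * fact (2 * (j + y)) * fact w)"
        using gbinomial_half[of "j + y" w] by (simp only: x diff_add_inverse)
      have first: "A gchoose i = (-1) ^ i * (fact (2 * (r + i)) * fact r / (4 ^ i * fact (r + i) * fact (2 * r) * fact i))"
        unfolding A_def by (rule gbinomial_negative_half)
      have d: "j + x + y - i = j + y + w" "j + r + x + y - i = j + r + y + w" 
        by (simp_all add: x)
      have third: "of_nat ((j + r + y) choose (j + r + i)) = (fact (j + r + y) / (fact (j + r + i) * fact z) :: rat)"
        by (simp add: binomial_fact y)
      have cx: "of_nat (x choose i) = (fact x / (fact i * fact w) :: rat)"
        by (simp add: binomial_fact x)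
      have cy: "of_nat (y choose i) = (fact y / (fact i * fact z) :: rat)"
        by (simp add: binomial_fact y)
      have p: "(4 :: rat) ^ x = 4 ^ i * 4 ^ w" by (simp add: x power_add)
      have a: "j + (r + i) = j + r + i" "j + y + w + r = j + r + y + w" "j + y + r = j + r + y" by simp_all
      show ?thesis
        unfolding t_def first second third d c_def rat_super_catalan_fact of_nat_mult cx cy p a
        by (simp add: divide_simps del: fact_Suc)
    next
      case False
      then show ?thesis by (simp add: t_def binomial_eq_0)
    qed
  qed
  finally show ?thesis .
qed

text \<open>
  Dixon's theorem for super Catalan numbers. By \<open>alternating_basis_sum\<close>, only the term
  \<open>i = N\<close> of the expansion of the product contributes; its sign \<open>(-1) ^ N\<close> cancels the one
  produced by the sum.
\<close>

lemma alternating_super_catalan_sum: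
  fixes j r N :: nat
  shows "(\<Sum>k\<le>2 * N. (-1) ^ k * of_nat ((2 * N) choose k)
        * (rat_super_catalan (j + k) r * rat_super_catalan (j + (2 * N - k)) r))
    = of_nat ((2 * N) choose N) * fact N * rat_super_catalan j (r + N) * rat_super_catalan (j + N) r
      * (fact (j + r + N) / fact (j + r + 2 * N))"
proof -
  define \<kappa> where "\<kappa> i = (-1) ^ i * fact i * rat_super_catalan j (r + i) * rat_super_catalan (j + 2 * N - i) r
         * (fact (j + r + 2 * N - i) / fact (j + r + 2 * N))" for i
  have expand: "rat_super_catalan (j + k) r * rat_super_catalan (j + (2 * N - k)) r
      = (\<Sum>i\<le>2 * N. \<kappa> i * of_nat ((k choose i) * ((2 * N - k) choose i)))" if "k \<le> 2 * N" for k
  proof -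
    have "rat_super_catalan (j + k) r * rat_super_catalan (j + (2 * N - k)) r
        = (\<Sum>i\<le>k. \<kappa> i * of_nat ((k choose i) * ((2 * N - k) choose i)))"
      unfolding super_catalan_product_expansion \<kappa>_def using that by (simp add: add.assoc)
    also have "\<dots> = (\<Sum>i\<le>2 * N. \<kappa> i * of_nat ((k choose i) * ((2 * N - k) choose i)))"
      using that by (intro sum.mono_neutral_left) (auto simp: binomial_eq_0)
    finally show ?thesis .
  qed
  have "(\<Sum>k\<le>2 * N. (-1) ^ k * of_nat ((2 * N) choose k)
        * (rat_super_catalan (j + k) r * rat_super_catalan (j + (2 * N - k)) r))
      = (\<Sum>k\<le>2 * N. \<Sum>i\<le>2 * N. \<kappa> i * ((-1) ^ k
          * of_nat (((2 * N) choose k) * (k choose i) * ((2 * N - k) choose i))))"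
    by (rule sum.cong[OF refl], subst expand) (simp_all add: sum_distrib_left mult_ac)
  also have "\<dots> = (\<Sum>i\<le>2 * N. \<kappa> i * (if i = N then (-1) ^ N * of_nat ((2 * N) choose N) else 0))"
    by (subst sum.swap) (simp only: sum_distrib_left[symmetric] alternating_basis_sum)
  also have "\<dots> = (\<Sum>i\<le>2 * N. if i = N then \<kappa> N * ((-1) ^ N * of_nat ((2 * N) choose N)) else 0)"
    by (rule sum.cong) auto
  also have "\<dots> = \<kappa> N * ((-1) ^ N * of_nat ((2 * N) choose N))"
    by (subst sum.delta) auto
  also have "\<dots> = of_nat ((2 * N) choose N) * fact N * rat_super_catalan j (r + N) * rat_super_catalan (j + N) r
      * (fact (j + r + N) / fact (j + r + 2 * N)) * ((-1) ^ N * (-1) ^ N)"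
    by (simp add: \<kappa>_def mult_2 add.assoc[symmetric])
  finally show ?thesis by (simp flip: power_mult_distrib)
qed

text \<open>
  The weight is traded by \<open>basis_sum_shift\<close> for the shift \<open>j = u\<close> and the shorter range
  \<open>N = n - u\<close>. The constants then recombine so that \<open>S(n, r)\<close> splits off with an integral
  cofactor.
\<close>

lemma weighted_alternating_super_catalan_sum:
  fixes n r u :: nat
  assumes "u \<le> n"
  shows "(\<Sum>k\<le>2 * n. (-1) ^ k * int (((2 * n) choose k) * (k choose u) * ((2 * n - k) choose u))
        * (super_catalan k r * super_catalan (2 * n - k) r))
    = (-1) ^ u * int (((2 * u) choose u) * (n choose u)) * super_catalan n (r + (n - u)) * super_catalan n r"
proof -
  obtain N where n: "n = u + N" using assms by (metis le_Suc_ex)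
  have S: "of_int (super_catalan a b) = rat_super_catalan a b" for a b
    by (simp add: super_catalan_eq rat_super_catalan_def)
  have "(\<Sum>k\<le>2 * n. (-1) ^ k * of_nat (((2 * n) choose k) * (k choose u) * ((2 * n - k) choose u))
        * (rat_super_catalan k r * rat_super_catalan (2 * n - k) r))
      = (\<Sum>k\<le>2 * n. of_nat (((2 * n) choose k) * (k choose u) * ((2 * n - k) choose u))
        * ((-1) ^ k * (rat_super_catalan k r * rat_super_catalan (2 * n - k) r)))"
    by (simp only: mult.assoc mult.left_commute[of "(-1) ^ _"])
  also have "\<dots> = of_nat (((2 * n) choose u) * ((2 * n - u) choose u))
      * (\<Sum>k\<le>2 * n - 2 * u. of_nat ((2 * n - 2 * u) choose k)
        * ((-1) ^ (k + u) * (rat_super_catalan (k + u) r * rat_super_catalan (2 * n - (k + u)) r)))"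
    by (rule basis_sum_shift) (use assms in simp)
  also have "(\<Sum>k\<le>2 * n - 2 * u. of_nat ((2 * n - 2 * u) choose k)
        * ((-1) ^ (k + u) * (rat_super_catalan (k + u) r * rat_super_catalan (2 * n - (k + u)) r)))
      = (-1) ^ u * (\<Sum>k\<le>2 * N. (-1) ^ k * of_nat ((2 * N) choose k)
        * (rat_super_catalan (u + k) r * rat_super_catalan (u + (2 * N - k)) r))"
    unfolding sum_distrib_left
  proof (rule sum.cong)
    show "{..2 * n - 2 * u} = {..2 * N}" by (simp add: n)
    fix k assume "k \<in> {..2 * N}"
    then have "2 * n - (k + u) = u + (2 * N - k)" "2 * n - 2 * u = 2 * N" by (simp_all add: n)
    then show "of_nat ((2 * n - 2 * u) choose k)
        * ((-1) ^ (k + u) * (rat_super_catalan (k + u) r * rat_super_catalan (2 * n - (k + u)) r))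
      = (-1) ^ u * ((-1) ^ k * of_nat ((2 * N) choose k)
        * (rat_super_catalan (u + k) r * rat_super_catalan (u + (2 * N - k)) r))"
      by (simp add: power_add add.commute[of k u] del: diff_diff_eq)
  qed
  also have "\<dots> = (-1) ^ u * (of_nat ((2 * N) choose N) * fact N * rat_super_catalan u (r + N)
      * rat_super_catalan (u + N) r * (fact (u + r + N) / fact (u + r + 2 * N)))"
    by (simp only: alternating_super_catalan_sum)
  also have "of_nat (((2 * n) choose u) * ((2 * n - u) choose u)) * \<dots>
      = (-1) ^ u * of_nat (((2 * u) choose u) * (n choose u))
       * rat_super_catalan n (r + (n - u)) * rat_super_catalan n r"
  proof -
    have c1: "(of_nat ((2 * n) choose u) :: rat) = fact (2 * n) / (fact u * fact (u + 2 * N))"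
      and c2: "(of_nat ((2 * n - u) choose u) :: rat) = fact (u + 2 * N) / (fact u * fact (2 * N))"
      and c3: "(of_nat ((2 * N) choose N) :: rat) = fact (2 * N) / (fact N * fact N)"
      and c4: "(of_nat ((2 * u) choose u) :: rat) = fact (2 * u) / (fact u * fact u)"
      and c5: "(of_nat (n choose u) :: rat) = fact n / (fact u * fact N)"
      by (simp_all add: binomial_fact n mult_2 add_ac)
    have e: "n - u = N" "u + N = n" "u + (r + N) = n + r" "u + r + N = n + r"
      "n + (r + N) = u + r + 2 * N" by (simp_all add: n)
    show ?thesis
      unfolding of_nat_mult c1 c2 c3 c4 c5 e rat_super_catalan_fact
      by (simp add: divide_simps del: fact_Suc)
  qed
  finally have "(of_int (\<Sum>k\<le>2 * n. (-1) ^ k * int (((2 * n) choose k) * (k choose u) * ((2 * n - k) choose u))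
        * (super_catalan k r * super_catalan (2 * n - k) r)) :: rat)
    = of_int ((-1) ^ u * int (((2 * u) choose u) * (n choose u)) * super_catalan n (r + (n - u)) * super_catalan n r)"
    by (simp add: S)
  then show ?thesis by (simp only: of_int_eq_iff)
qed

section \<open>Divisibility\<close>

text \<open>
  The exponent is written \<open>Suc m\<close> because the closed form at the start of the induction uses one
  factor \<open>(2 * n) choose k\<close>. Each further factor is absorbed into the weight by
  \<open>binomial_times_basis\<close>, so the induction has to run over all \<open>u\<close> at once.
\<close>

lemma half_super_catalan_dvd_basis_sum:
  fixes n r u m :: nat
  assumes "r \<ge> 1"
  shows "super_catalan n r div 2 dvd
    (\<Sum>k\<le>2 * n. (-1) ^ k * int (((2 * n) choose k) ^ Suc m * ((k choose u) * ((2 * n - k) choose u)))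
        * ((super_catalan k r div 2) * (super_catalan (2 * n - k) r div 2)))"
proof (induction m arbitrary: u)
  case 0
  show ?case
  proof (cases "u \<le> n")
    case True
    have S: "super_catalan a b = 2 * (super_catalan a b div 2)" if "b \<ge> 1" for a b
      using even_super_catalan[OF that] by simp
    let ?s = "\<lambda>k. super_catalan k r div 2"
    \<comment> \<open>This halving is exact because \<open>r + (n - u) \<ge> 1\<close>.\<close>
    let ?t = "super_catalan n (r + (n - u)) div 2"
    have "(\<Sum>k\<le>2 * n. (-1) ^ k * int (((2 * n) choose k) * (k choose u) * ((2 * n - k) choose u))
        * ((2 * ?s k) * (2 * ?s (2 * n - k))))
      = (-1) ^ u * int (((2 * u) choose u) * (n choose u)) * (2 * ?t) * (2 * ?s n)"
      using weighted_alternating_super_catalan_sum[OF True, of r] assms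
      by (simp only: S[symmetric] trans_le_add1)
    then have "4 * (\<Sum>k\<le>2 * n. (-1) ^ k * int (((2 * n) choose k) * (k choose u) * ((2 * n - k) choose u))
        * (?s k * ?s (2 * n - k)))
      = 4 * ((-1) ^ u * int (((2 * u) choose u) * (n choose u)) * ?t * ?s n)"
      by (simp add: sum_distrib_left mult_ac)
    then have "(\<Sum>k\<le>2 * n. (-1) ^ k * int (((2 * n) choose k) * (k choose u) * ((2 * n - k) choose u))
        * (?s k * ?s (2 * n - k)))
      = (-1) ^ u * int (((2 * u) choose u) * (n choose u)) * ?t * ?s n"
      by simp
    then show ?thesis by (simp add: mult.assoc)
  next
    case False
    then have "(k choose u) * ((2 * n - k) choose u) = 0" for k
      by (auto simp: binomial_eq_0_iff)
    then show ?thesis by (simp only: mult_zero_right mult_zero_left of_nat_0 sum.neutral_const dvd_0_right)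
  qed
next
  case (Suc m)
  let ?g = "\<lambda>k. (super_catalan k r div 2) * (super_catalan (2 * n - k) r div 2)"
  have basis: "((2 * n) choose k) * ((k choose u) * ((2 * n - k) choose u))
      = (\<Sum>v\<le>2 * n. ((2 * n) choose u) * (v choose u) * ((k choose v) * ((2 * n - k) choose v)))"
    if "k \<le> 2 * n" for k
  proof -
    have "((2 * n) choose k) * ((k choose u) * ((2 * n - k) choose u))
        = ((2 * n) choose u) * (\<Sum>v\<le>k. (v choose u) * (k choose v) * ((2 * n - k) choose v))"
      using binomial_times_basis[of k "2 * n - k" u] that by (simp add: mult.assoc)
    also have "(\<Sum>v\<le>k. (v choose u) * (k choose v) * ((2 * n - k) choose v))
        = (\<Sum>v\<le>2 * n. (v choose u) * (k choose v) * ((2 * n - k) choose v))"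
      using that by (intro sum.mono_neutral_left) (auto simp: binomial_eq_0)
    finally show ?thesis by (simp add: sum_distrib_left mult_ac)
  qed
  have "(\<Sum>k\<le>2 * n. (-1) ^ k * int (((2 * n) choose k) ^ Suc (Suc m) * ((k choose u) * ((2 * n - k) choose u))) * ?g k)
      = (\<Sum>k\<le>2 * n. (-1) ^ k * int (((2 * n) choose k) ^ Suc m
          * (((2 * n) choose k) * ((k choose u) * ((2 * n - k) choose u)))) * ?g k)"
    by (simp add: mult_ac)
  also have "\<dots> = (\<Sum>k\<le>2 * n. \<Sum>v\<le>2 * n. int (((2 * n) choose u) * (v choose u))
        * ((-1) ^ k * int (((2 * n) choose k) ^ Suc m * ((k choose v) * ((2 * n - k) choose v))) * ?g k))"
    by (rule sum.cong[OF refl], subst basis)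
      (simp_all only: atMost_iff sum_distrib_left sum_distrib_right of_nat_sum of_nat_mult mult_ac)
  also have "\<dots> = (\<Sum>v\<le>2 * n. int (((2 * n) choose u) * (v choose u)) * (\<Sum>k\<le>2 * n.
        (-1) ^ k * int (((2 * n) choose k) ^ Suc m * ((k choose v) * ((2 * n - k) choose v))) * ?g k))"
    by (subst sum.swap) (simp only: sum_distrib_left)
  finally show ?case
    by (simp only:) (intro dvd_sum dvd_mult Suc.IH)
qed

text \<open>
  With \<open>r = Suc p\<close>, the factor \<open>r / (k + r)\<close> of a Gessel number is
  \<open>((k + p) choose p) / ((k + r) choose k)\<close>.
\<close>

lemma gessel_eq_half_super_catalan:
  fixes k p :: nat
  shows "gessel k (Suc p) = (super_catalan k (Suc p) div 2) * int ((k + p) choose p)"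
proof -
  have "Suc p * ((k + Suc p) choose k) = (k + Suc p) * ((k + p) choose p)"
    using binomial_absorption[of p "k + Suc p"] binomial_symmetric[of k "k + Suc p"] by simp
  then have c: "(of_nat (Suc p) * of_nat ((k + Suc p) choose k) :: rat)
      = of_nat (k + Suc p) * of_nat ((k + p) choose p)"
    by (metis of_nat_mult)
  have nz: "(of_nat (k + Suc p) :: rat) \<noteq> 0" "(of_nat ((k + Suc p) choose k) :: rat) \<noteq> 0"
    by (simp_all del: of_nat_Suc of_nat_add)
  then have ratio: "(of_nat (Suc p) / of_nat (k + Suc p) :: rat)
      = of_nat ((k + p) choose p) / of_nat ((k + Suc p) choose k)"
    using c by (simp add: frac_eq_eq mult.commute del: of_nat_Suc of_nat_add)
  have "(of_int (2 * gessel k (Suc p)) :: rat) = (of_nat (Suc p) / of_nat (k + Suc p))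
      * (of_nat ((2 * k) choose k) * of_nat ((2 * Suc p) choose Suc p))"
  proof -
    have "2 * (R / (2 * t) * B * C) = R / t * (B * C)" for R t B C :: rat
      by simp
    then show ?thesis
      using gessel_eq[of "Suc p" k] by (simp only: of_int_mult of_int_numeral of_nat_add le_add1 plus_1_eq_Suc)
  qed
  also have "\<dots> = of_int (super_catalan k (Suc p) * int ((k + p) choose p))"
    unfolding ratio by (simp add: super_catalan_eq del: of_nat_Suc binomial_Suc_Suc)
  finally have "(of_int (2 * gessel k (Suc p)) :: rat) = of_int (super_catalan k (Suc p) * int ((k + p) choose p))" .
  then have "2 * gessel k (Suc p) = super_catalan k (Suc p) * int ((k + p) choose p)"
    by (simp only: of_int_eq_iff)
  moreover have "super_catalan k (Suc p) = 2 * (super_catalan k (Suc p) div 2)"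
    using even_super_catalan[of "Suc p" k] by simp
  ultimately have "2 * gessel k (Suc p) = 2 * ((super_catalan k (Suc p) div 2) * int ((k + p) choose p))"
    by (metis mult.assoc)
  then show ?thesis by linarith
qed

theorem theorem1:
  fixes n m r :: nat
  assumes "m \<ge> 1" and "r \<ge> 1"
  shows "super_catalan n r div 2 dvd
    (\<Sum>k=0..2*n. (-1) ^ k * int ((2 * n) choose k) ^ m * gessel k r * gessel (2 * n - k) r)"
proof -
  obtain p where r: "r = Suc p" using assms(2) by (cases r) auto
  obtain l where m: "m = Suc l" using assms(1) by (cases m) auto
  let ?g = "\<lambda>k. (super_catalan k r div 2) * (super_catalan (2 * n - k) r div 2)"
  \<comment> \<open>The coefficients do not depend on \<open>k\<close>, so the sums over \<open>k\<close> and \<open>u\<close> can be exchanged.\<close>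
  have weight: "((k + p) choose p) * ((2 * n - k + p) choose p)
      = (\<Sum>u\<le>p. ((2 * n + p - u) choose (p - u)) * ((k choose u) * ((2 * n - k) choose u)))"
    if "k \<le> 2 * n" for k
    using binomial_product_expansion[of k p "2 * n - k"] that by (simp add: mult.assoc)
  have "(\<Sum>k=0..2*n. (-1) ^ k * int ((2 * n) choose k) ^ m * gessel k r * gessel (2 * n - k) r)
      = (\<Sum>k\<le>2 * n. (-1) ^ k * int (((2 * n) choose k) ^ Suc l
          * (((k + p) choose p) * ((2 * n - k + p) choose p))) * ?g k)"
    by (simp add: atMost_atLeast0 r m gessel_eq_half_super_catalan mult_ac)
  also have "\<dots> = (\<Sum>k\<le>2 * n. \<Sum>u\<le>p. int ((2 * n + p - u) choose (p - u))
        * ((-1) ^ k * int (((2 * n) choose k) ^ Suc l * ((k choose u) * ((2 * n - k) choose u))) * ?g k))"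
    by (rule sum.cong[OF refl], subst weight)
      (simp_all only: atMost_iff sum_distrib_left sum_distrib_right of_nat_sum of_nat_mult mult_ac)
  also have "\<dots> = (\<Sum>u\<le>p. int ((2 * n + p - u) choose (p - u)) * (\<Sum>k\<le>2 * n.
        (-1) ^ k * int (((2 * n) choose k) ^ Suc l * ((k choose u) * ((2 * n - k) choose u))) * ?g k))"
    by (subst sum.swap) (simp only: sum_distrib_left)
  finally show ?thesis
    by (simp only:) (intro dvd_sum dvd_mult half_super_catalan_dvd_basis_sum assms)
qed

end
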